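(* For all real $p>1$ and $m\ge0$, $$I_p(m):=m^{2(p-1)}(p-1)\sum_{n=1}^\infty\frac{2n+1}{(m^2+n^2+n)^p}<1.$$ *)

theory Defs
  imports Complex_Main
begin

definition I_term :: "real \<Rightarrow> real \<Rightarrow> nat \<Rightarrow> real" where
  "I_term p m n = (2 * real n + 1) / (m\<^sup>2 + (real n)\<^sup>2 + real n) powr p"

(* The series starts at n = 1, hence the shift by Suc.  For m = 0 the prefactor
   is 0 powr (2 * (p - 1)) = 0, the usual value of 0 to a positive exponent. *)
definition I :: "real \<Rightarrow> real \<Rightarrow> real" where
  "I p m = m powr (2 * (p - 1)) * (p - 1) * (\<Sum>n. I_term p m (Suc n))"

end

theory Submission imports Defs begin

text \<open>
  Put \<open>a = m\<^sup>2\<close>. In the variable \<open>y = x\<^sup>2 + x\<close> the series is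
  \<open>\<Sum> (2 n + 1) \<phi> (n\<^sup>2 + n)\<close> with the convex function \<open>\<phi> y = (a + y) powr - p\<close>. The weight
  \<open>2 n + 1\<close> is the length of the interval \<open>[n\<^sup>2 - 1/2, (n + 1)\<^sup>2 - 1/2]\<close>, whose midpoint is exactly
  \<open>n\<^sup>2 + n\<close>. By the midpoint (Hermite--Hadamard) inequality for convex functions, each term is
  therefore at most the integral of \<open>\<phi>\<close> over that interval. For \<open>n \<ge> 1\<close> these intervals tile
  \<open>[1/2, \<infinity>)\<close>, so the series is at most the
  integral of \<open>\<phi>\<close> over that half-line, which is \<open>(a + 1/2) powr (1 - p) / (p - 1)\<close>.
  Multiplying by \<open>a powr (p - 1) * (p - 1)\<close> leaves \<open>(a / (a + 1/2)) powr (p - 1) < 1\<close>.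

  The integrals appear below only through the antiderivative \<open>- (a + y) powr (1 - p) / (p - 1)\<close>, so that
  adding them up becomes a telescoping sum. The two lemmas that carry the argument are
  \<open>powr_hermite_hadamard_midpoint\<close> and \<open>I_term_le_telescope\<close>.
\<close>

text \<open>
  The arithmetic-geometric mean inequality bounds the right-hand side below by
  \<open>2 * ((c - h) * (c + h)) powr (- p / 2)\<close>, and \<open>(c - h) * (c + h) \<le> c\<^sup>2\<close>.
\<close>

lemma powr_minus_midpoint_convex:
  fixes c h p :: real
  assumes "0 < p" "0 \<le> h" "h < c"
  shows "2 * c powr (- p) \<le> (c - h) powr (- p) + (c + h) powr (- p)"
proof -
  define u v where "u = (c - h) powr (- p / 2)" and "v = (c + h) powr (- p / 2)"
  have "(c - h) * (c + h) \<le> c * c"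
    by (simp add: algebra_simps)
  then have "(c * c) powr (- p / 2) \<le> ((c - h) * (c + h)) powr (- p / 2)"
    using assms by (intro powr_mono2') auto
  then have "c powr (- p) \<le> u * v"
    using assms by (simp add: u_def v_def powr_mult flip: powr_add)
  moreover have "2 * (u * v) \<le> u * u + v * v"
    using sum_squares_bound[of u v] by (simp add: power2_eq_square)
  moreover have "u * u = (c - h) powr (- p)" "v * v = (c + h) powr (- p)"
    by (simp_all add: u_def v_def flip: powr_add)
  ultimately show ?thesis by linarith
qed

text \<open>
  The right-hand side is \<open>p - 1\<close> times the integral of \<open>x powr - p\<close> over \<open>[c - h, c + h]\<close>. Both sides vanish
  at \<open>h = 0\<close>, and the \<open>h\<close>-derivative of their difference is \<open>p - 1\<close> times the defect in the
  midpoint convexity inequality.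
\<close>

lemma powr_hermite_hadamard_midpoint:
  fixes c h p :: real
  assumes "1 < p" "0 \<le> h" "h < c"
  shows "(p - 1) * (2 * h * c powr (- p)) \<le> (c - h) powr (1 - p) - (c + h) powr (1 - p)"
proof -
  define g where
    "g = (\<lambda>t. (c - t) powr (1 - p) - (c + t) powr (1 - p) - (p - 1) * (2 * t * c powr (- p)))"
  have "g 0 \<le> g h"
  proof (rule DERIV_nonneg_imp_nondecreasing[OF \<open>0 \<le> h\<close>])
    fix t assume t: "0 \<le> t" "t \<le> h"
    let ?d = "(p - 1) * ((c - t) powr (- p) + (c + t) powr (- p) - 2 * c powr (- p))"
    have "(g has_real_derivative ?d) (at t)"
      unfolding g_def using t assms
      by (auto intro!: derivative_eq_intros simp: algebra_simps)
    moreover have "0 \<le> ?d"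
      using powr_minus_midpoint_convex[of p t c] t assms by simp
    ultimately show "\<exists>d. (g has_real_derivative d) (at t) \<and> 0 \<le> d"
      by blast
  qed
  then show ?thesis by (simp add: g_def)
qed

text \<open>
  The term with index \<open>n\<close> against the integral over \<open>[n\<^sup>2 - 1/2, (n + 1)\<^sup>2 - 1/2]\<close>, shifted by
  \<open>m\<^sup>2\<close>. The condition \<open>1 \<le> n\<close> keeps the shifted interval inside the positive half-line even
  for \<open>m = 0\<close>.
\<close>

lemma I_term_le_telescope:
  fixes p m :: real
  assumes "1 < p" "1 \<le> n"
  shows "I_term p m n \<le> (m\<^sup>2 + (real n)\<^sup>2 - 1/2) powr (1 - p) / (p - 1)
                      - (m\<^sup>2 + (real (Suc n))\<^sup>2 - 1/2) powr (1 - p) / (p - 1)"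
proof -
  define c h where "c = m\<^sup>2 + (real n)\<^sup>2 + real n" and "h = real n + 1/2"
  have "1 \<le> (real n)\<^sup>2"
    using assms by (simp add: one_le_power)
  moreover have "0 \<le> m\<^sup>2" by simp
  ultimately have "h < c" "0 \<le> h"
    unfolding c_def h_def by linarith+
  then have "(p - 1) * (2 * h * c powr (- p)) \<le> (c - h) powr (1 - p) - (c + h) powr (1 - p)"
    using assms by (intro powr_hermite_hadamard_midpoint) auto
  moreover have "c - h = m\<^sup>2 + (real n)\<^sup>2 - 1/2" "c + h = m\<^sup>2 + (real (Suc n))\<^sup>2 - 1/2"
    by (simp_all add: c_def h_def power2_eq_square algebra_simps)
  moreover have "I_term p m n = 2 * h * c powr (- p)"
    by (simp add: I_term_def c_def h_def powr_minus_divide)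
  ultimately show ?thesis
    using assms by (simp add: pos_le_divide_eq mult.commute flip: diff_divide_distrib)
qed

theorem proposition3p1:
  fixes p m :: real
  assumes "p > 1" and "m \<ge> 0"
  shows "summable (\<lambda>n. I_term p m (Suc n)) \<and> I p m < 1"
proof -
  \<comment> \<open>Up to sign, the antiderivative of \<open>\<phi>\<close> at the left endpoint of the interval around the midpoint
    for the index \<open>n + 1\<close>, since the series starts at \<open>1\<close>.\<close>
  define G where "G = (\<lambda>n. (m\<^sup>2 + (real (Suc n))\<^sup>2 - 1/2) powr (1 - p) / (p - 1))"
  have le: "I_term p m (Suc n) \<le> G n - G (Suc n)" for n
    using I_term_le_telescope[of p "Suc n" m] assms by (simp add: G_def)
  have "filterlim (\<lambda>n. (m\<^sup>2 - 1/2) + (real (Suc n))\<^sup>2) at_top sequentially"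
    by (intro filterlim_tendsto_add_at_top[OF tendsto_const] filterlim_pow_at_top
        filterlim_compose[OF filterlim_real_sequentially filterlim_Suc]) simp
  then have "(\<lambda>n. ((m\<^sup>2 - 1/2) + (real (Suc n))\<^sup>2) powr (1 - p)) \<longlonglongrightarrow> 0"
    using assms by (intro tendsto_neg_powr) auto
  then have "G \<longlonglongrightarrow> 0 / (p - 1)"
    unfolding G_def using assms by (intro tendsto_divide tendsto_const) (simp_all add: algebra_simps)
  then have tel: "(\<lambda>n. G n - G (Suc n)) sums G 0"
    using telescope_sums'[of G 0] by simp
  have summable: "summable (\<lambda>n. I_term p m (Suc n))"
  proof (rule summable_comparison_test)
    show "\<exists>N. \<forall>n\<ge>N. norm (I_term p m (Suc n)) \<le> G n - G (Suc n)"
      using le by (simp add: I_term_def)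
    show "summable (\<lambda>n. G n - G (Suc n))"
      using tel by (rule sums_summable)
  qed
  have sum_le: "(\<Sum>n. I_term p m (Suc n)) \<le> G 0"
    using suminf_le[OF le summable sums_summable[OF tel]] sums_unique[OF tel] by simp
  have "I p m < 1"
  proof (cases "m = 0")
    case True
    then show ?thesis by (simp add: I_def)
  next
    case False
    then have m: "0 < m" using assms by simp
    have "I p m \<le> m powr (2 * (p - 1)) * (p - 1) * G 0"
      unfolding I_def using sum_le assms by (intro mult_left_mono) auto
    also have "\<dots> = (m\<^sup>2) powr (p - 1) * (m\<^sup>2 + 1/2) powr (1 - p)"
      using m assms by (simp add: G_def powr_powr add.commute flip: powr_numeral)
    also have "\<dots> = (m\<^sup>2) powr (p - 1) / (m\<^sup>2 + 1/2) powr (p - 1)"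
      using powr_minus_divide[of "m\<^sup>2 + 1/2" "p - 1"] by simp
    also have "\<dots> < 1"
    proof -
      have "(m\<^sup>2) powr (p - 1) < (m\<^sup>2 + 1/2) powr (p - 1)"
        using assms by (intro powr_less_mono2) auto
      then show ?thesis
        by (simp add: divide_less_eq)
    qed
    finally show ?thesis .
  qed
  with summable show ?thesis by blast
qed

end
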